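(* Let $t \ge 1$ and $n_1,\ldots,n_t$ be positive integers such that the direct product $K_{n_1}\times K_{n_2}\times\cdots\times K_{n_t}$ is connected. Then the domination polynomial of $K_{n_1}\times\cdots\times K_{n_t}$ is unimodal.
   Context: For a finite simple graph $G$, a set $U \subseteq V(G)$ is dominating if every vertex is in $U$ or adjacent to a vertex of $U$; $d_i(G)$ is the number of dominating sets of size $i$ and $D(G,x)=\sum_{i} d_i(G)x^i$ is the domination polynomial. A polynomial is unimodal if its coefficients (ordered by increasing power of $x$) are non-decreasing and then non-increasing. $K_n$ denotes the complete graph on $n$ vertices. The direct product $G\times H$ of graphs $G,H$ has vertex set $V(G)\times V(H)$, with $(g,h)$ adjacent to $(g',h')$ iff $\{g,g'\}\in E(G)$ and $\{h,h'\}\in E(H)$; products of several graphs are defined associatively. *)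

theory Defs
  imports
    "Graph_Theory.Graph_Theory"
    "HOL-Computational_Algebra.Polynomial"
begin

text \<open>
  Finite simple graphs are rendered as the symmetric loop-free finite digraphs
  \<^locale>\<open>pair_graph\<close>: an undirected edge is a pair of opposite arcs.
\<close>

definition complete_graph :: "nat \<Rightarrow> nat pair_pre_digraph" where
  "complete_graph n = \<lparr> pverts = {..<n}, parcs = {(u, v). u < n \<and> v < n \<and> u \<noteq> v} \<rparr>"

lemma complete_digraph_complete_graph: "complete_digraph n (with_proj (complete_graph n))"
  unfolding complete_digraph_pair_def by (auto simp: complete_graph_def)

definition direct_product ::
    "'a pair_pre_digraph \<Rightarrow> 'b pair_pre_digraph \<Rightarrow> ('a \<times> 'b) pair_pre_digraph" where
  "direct_product G H =
     \<lparr> pverts = pverts G \<times> pverts H,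
       parcs = {((g, h), (g', h')). (g, g') \<in> parcs G \<and> (h, h') \<in> parcs H} \<rparr>"

lemma pair_graph_direct_product:
  assumes "pair_graph G" "pair_graph H"
  shows "pair_graph (direct_product G H)"
proof -
  interpret G: pair_graph G by fact
  interpret H: pair_graph H by fact
  have sub: "parcs (direct_product G H) \<subseteq>
      (pverts G \<times> pverts H) \<times> (pverts G \<times> pverts H)"
    by (auto simp: direct_product_def dest: G.wellformed' H.wellformed')
  have fin: "finite (pverts G \<times> pverts H)" by simp
  have "finite (parcs (direct_product G H))"
    by (rule finite_subset[OF sub]) (intro finite_cartesian_product fin G.finite_verts H.finite_verts)
  moreover have "symmetric (with_proj (direct_product G H))"
    using G.sym_arcs H.sym_arcs
    by (auto simp: symmetric_def direct_product_def intro!: symI dest: symD)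
  moreover have "fst e \<noteq> snd e" if "e \<in> parcs (direct_product G H)" for e
    using that by (auto simp: direct_product_def dest: G.pair_no_loops)
  ultimately show ?thesis
    using fin
    by unfold_locales
      (auto simp: direct_product_def dest: G.wellformed' H.wellformed')
qed

definition relabel :: "('a \<Rightarrow> 'b) \<Rightarrow> 'a pair_pre_digraph \<Rightarrow> 'b pair_pre_digraph" where
  "relabel f G = \<lparr> pverts = f ` pverts G, parcs = map_prod f f ` parcs G \<rparr>"

text \<open>
  The iterated binary product \<open>G\<^sub>1 \<times> (G\<^sub>2 \<times> (\<dots> \<times> G\<^sub>t))\<close>. The type of its nested-pair vertices
  would depend on \<open>t\<close>, so they are flattened to lists of length \<open>t\<close> by the injective relabelling
  that sends \<open>(v, vs)\<close> to \<open>v # vs\<close>. The product of no graphs is left unspecified.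
\<close>

fun direct_product_list :: "'a pair_pre_digraph list \<Rightarrow> 'a list pair_pre_digraph" where
  "direct_product_list [G] = relabel (\<lambda>v. [v]) G"
| "direct_product_list (G # H # Gs) =
     relabel (\<lambda>(v, vs). v # vs) (direct_product G (direct_product_list (H # Gs)))"

lemma pverts_direct_product_list:
  "Gs \<noteq> [] \<Longrightarrow>
   pverts (direct_product_list Gs) = {vs. list_all2 (\<lambda>v G. v \<in> pverts G) vs Gs}"
  by (induction Gs rule: direct_product_list.induct)
    (auto simp: relabel_def direct_product_def list_all2_Cons2 image_iff)

lemma parcs_direct_product_list:
  "Gs \<noteq> [] \<Longrightarrow>
   parcs (direct_product_list Gs) =
     {(us, vs). length us = length Gs \<and> length vs = length Gs \<and>
        (\<forall>i < length Gs. (us ! i, vs ! i) \<in> parcs (Gs ! i))}"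
proof (induction Gs rule: direct_product_list.induct)
  case (1 G)
  show ?case
    by (auto simp: relabel_def image_iff length_Suc_conv)
next
  case (2 G H Gs)
  have cons: "((us, vs) \<in> parcs (direct_product_list (G # H # Gs))) \<longleftrightarrow>
      (\<exists>u us' v vs'. us = u # us' \<and> vs = v # vs' \<and> (u, v) \<in> parcs G \<and>
         (us', vs') \<in> parcs (direct_product_list (H # Gs)))" for us vs
    by (auto simp: relabel_def direct_product_def image_iff)
  have IH: "parcs (direct_product_list (H # Gs)) =
      {(us, vs). length us = length (H # Gs) \<and> length vs = length (H # Gs) \<and>
        (\<forall>i < length (H # Gs). (us ! i, vs ! i) \<in> parcs ((H # Gs) ! i))}"
    using 2 by blast
  have "((us, vs) \<in> parcs (direct_product_list (G # H # Gs))) \<longleftrightarrow>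
      length us = length (G # H # Gs) \<and> length vs = length (G # H # Gs) \<and>
      (\<forall>i < length (G # H # Gs). (us ! i, vs ! i) \<in> parcs ((G # H # Gs) ! i))" for us vs
    unfolding cons IH
    by (cases us; cases vs) (simp_all add: All_less_Suc2 conj_ac del: direct_product_list.simps)
  then show ?case by blast
qed simp

definition dominating_set :: "'a pair_pre_digraph \<Rightarrow> 'a set \<Rightarrow> bool" where
  "dominating_set G U \<longleftrightarrow>
     U \<subseteq> pverts G \<and> (\<forall>v \<in> pverts G. v \<in> U \<or> (\<exists>u \<in> U. (u, v) \<in> parcs G))"

definition num_dominating_sets :: "'a pair_pre_digraph \<Rightarrow> nat \<Rightarrow> nat" where
  "num_dominating_sets G i = card {U. dominating_set G U \<and> card U = i}"

definition domination_polynomial :: "'a pair_pre_digraph \<Rightarrow> int poly" where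
  "domination_polynomial G =
     (\<Sum>i \<le> card (pverts G). monom (int (num_dominating_sets G i)) i)"

lemma coeff_domination_polynomial:
  assumes "finite (pverts G)"
  shows "coeff (domination_polynomial G) i = int (num_dominating_sets G i)"
proof (cases "i \<le> card (pverts G)")
  case False
  then have "{U. dominating_set G U \<and> card U = i} = {}"
    using card_mono[OF assms] by (auto simp: dominating_set_def)
  then have "num_dominating_sets G i = 0"
    by (simp only: num_dominating_sets_def card.empty)
  with False show ?thesis
    by (simp add: domination_polynomial_def coeff_sum)
qed (simp add: domination_polynomial_def coeff_sum)

definition unimodal_poly :: "'a::{zero, ord} poly \<Rightarrow> bool" where
  "unimodal_poly p \<longleftrightarrow>
     (\<exists>k \<le> degree p.
        (\<forall>i < k. coeff p i \<le> coeff p (Suc i)) \<and>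
        (\<forall>i. k \<le> i \<and> i < degree p \<longrightarrow> coeff p (Suc i) \<le> coeff p i))"

end

theory Submission
  imports Defs
begin

text \<open>
  Let \<open>G\<close> have \<open>n\<close> vertices and all closed neighbourhoods of size \<open>c\<close>. Dominating sets are closed
  under supersets, so double counting the inclusions between consecutive levels gives
  \<open>d\<^sub>i \<le> d\<^sub>i\<^sub>+\<^sub>1\<close> for \<open>2i < n\<close>. A non-dominating set misses a closed neighbourhood, so there are at
  most \<open>n * ((n - c) choose i)\<close> of them on level \<open>i\<close>; whenever this is at most
  \<open>(n choose i) - (n choose (i + 1))\<close>, we get \<open>d\<^sub>i\<^sub>+\<^sub>1 \<le> d\<^sub>i\<close>. This is needed only for
  \<open>2i \<ge> n + 2\<close>. There \<open>(n choose i) \<ge> 2\<^sup>c * ((n - c) choose i)\<close>, so it suffices that \<open>n (n + 4) \<le> 6 * 2\<^sup>c\<close>.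

  Connectedness excludes factors \<open>K\<^sub>1\<close> (unless the product is a single vertex) and two factors
  \<open>K\<^sub>2\<close>. With at most one factor \<open>K\<^sub>2\<close>, either \<open>n - c < i\<close> throughout the relevant range,
  or the exponential bound holds, or the product is \<open>K\<^sub>2 \<times> K\<^sub>3 \<times> K\<^sub>3\<close> or
  \<open>K\<^sub>2 \<times> K\<^sub>3 \<times> K\<^sub>3 \<times> K\<^sub>3\<close>, where the exact binomial coefficients suffice.
\<close>

section \<open>Counting dominating sets of consecutive sizes\<close>

lemma card_upward_closed_step:
  fixes P :: "'a set \<Rightarrow> bool"
  assumes "finite V"
    and mono: "\<And>U x. P U \<Longrightarrow> U \<subseteq> V \<Longrightarrow> x \<in> V \<Longrightarrow> P (insert x U)"
  shows "card {U. P U \<and> U \<subseteq> V \<and> card U = i} * (card V - i)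
           \<le> card {U. P U \<and> U \<subseteq> V \<and> card U = Suc i} * Suc i"
proof -
  let ?D = "\<lambda>i. {U. P U \<and> U \<subseteq> V \<and> card U = i}"
  have fin: "finite (?D j)" for j
    by (rule finite_subset[of _ "Pow V"]) (use \<open>finite V\<close> in auto)
  have finU: "finite U" if "U \<in> ?D j" for U j
    using that \<open>finite V\<close> finite_subset by auto
  have "card (?D i) * (card V - i) = (\<Sum>U\<in>?D i. card (V - U))"
  proof -
    have "card (V - U) = card V - i" if "U \<in> ?D i" for U
      using that finU[OF that] by (auto simp: card_Diff_subset)
    then show ?thesis by simp
  qed
  also have "\<dots> = card (SIGMA U:?D i. V - U)"
    using fin \<open>finite V\<close> by (intro card_SigmaI[symmetric]) auto
  \<comment> \<open>Since x is not in U, the pair (\<open>insert x U\<close>, x) determines (U,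
    x).\<close>
  also have "\<dots> \<le> card (SIGMA W:?D (Suc i). W)"
  proof (rule card_inj_on_le)
    show "inj_on (\<lambda>(U, x). (insert x U, x)) (SIGMA U:?D i. V - U)"
      by (rule inj_on_inverseI[of _ "\<lambda>(W, x). (W - {x}, x)"]) auto
    show "(\<lambda>(U, x). (insert x U, x)) ` (SIGMA U:?D i. V - U) \<subseteq> (SIGMA W:?D (Suc i). W)"
      using mono finU by auto
    show "finite (SIGMA W:?D (Suc i). W)"
      by (intro finite_SigmaI fin) (rule finU)
  qed
  also have "\<dots> = (\<Sum>W\<in>?D (Suc i). card W)"
    by (intro card_SigmaI fin ballI) (rule finU)
  also have "\<dots> = card (?D (Suc i)) * Suc i" by simp
  finally show ?thesis .
qed

definition closed_nbhd :: "'a pair_pre_digraph \<Rightarrow> 'a \<Rightarrow> 'a set" where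
  "closed_nbhd G v = {u \<in> pverts G. u = v \<or> (u, v) \<in> parcs G}"

lemma dominating_set_iff:
  "dominating_set G U \<longleftrightarrow> U \<subseteq> pverts G \<and> (\<forall>v \<in> pverts G. U \<inter> closed_nbhd G v \<noteq> {})"
  unfolding dominating_set_def closed_nbhd_def by blast

lemma num_dominating_sets_mono:
  assumes "finite (pverts G)" "2 * i < card (pverts G)"
  shows "num_dominating_sets G i \<le> num_dominating_sets G (Suc i)"
proof -
  have eq: "{U. dominating_set G U \<and> U \<subseteq> pverts G \<and> card U = j} =
      {U. dominating_set G U \<and> card U = j}" for j
    by (auto simp: dominating_set_def)
  have "num_dominating_sets G i * (card (pverts G) - i) \<le> num_dominating_sets G (Suc i) * Suc i"
    unfolding num_dominating_sets_def using assms(1)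
    by (rule card_upward_closed_step[of "pverts G" "dominating_set G" i, unfolded eq])
      (auto simp: dominating_set_def)
  moreover have "num_dominating_sets G i * Suc i \<le> num_dominating_sets G i * (card (pverts G) - i)"
    using assms(2) by (intro mult_le_mono2) auto
  ultimately have "num_dominating_sets G i * Suc i \<le> num_dominating_sets G (Suc i) * Suc i"
    by linarith
  then show ?thesis by (simp only: mult_le_cancel2)
qed

lemma num_dominating_sets_le_choose:
  assumes "finite (pverts G)"
  shows "num_dominating_sets G i \<le> card (pverts G) choose i"
  unfolding num_dominating_sets_def n_subsets[OF assms, symmetric] using assms
  by (intro card_mono) (auto simp: dominating_set_def)

lemma choose_le_num_dominating_sets:
  assumes fin: "finite (pverts G)" and c: "\<And>v. v \<in> pverts G \<Longrightarrow> c \<le> card (closed_nbhd G v)"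
  defines "n \<equiv> card (pverts G)"
  shows "n choose i \<le> num_dominating_sets G i + n * ((n - c) choose i)"
proof -
  let ?V = "pverts G"
  let ?D = "{U. dominating_set G U \<and> card U = i}"
  let ?R = "\<lambda>v. {U. U \<subseteq> ?V - closed_nbhd G v \<and> card U = i}"
  have finR: "finite (?R v)" for v
    by (rule finite_subset[of _ "Pow ?V"]) (use fin in auto)
  have "n choose i = card {U. U \<subseteq> ?V \<and> card U = i}"
    by (simp add: n_def n_subsets fin)
  also have "\<dots> \<le> card (?D \<union> (\<Union>v\<in>?V. ?R v))"
  proof (rule card_mono)
    have "finite ?D"
      by (rule finite_subset[of _ "Pow ?V"]) (use fin in \<open>auto simp: dominating_set_def\<close>)
    then show "finite (?D \<union> (\<Union>v\<in>?V. ?R v))"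
      using fin finR by simp
  qed (auto simp: dominating_set_iff)
  also have "\<dots> \<le> num_dominating_sets G i + card (\<Union>v\<in>?V. ?R v)"
    unfolding num_dominating_sets_def by (rule card_Un_le)
  also have "card (\<Union>v\<in>?V. ?R v) \<le> (\<Sum>v\<in>?V. card (?R v))"
    by (rule card_UN_le[OF fin])
  also have "\<dots> \<le> (\<Sum>v\<in>?V. (n - c) choose i)"
  proof (rule sum_mono)
    fix v assume v: "v \<in> ?V"
    have sub: "closed_nbhd G v \<subseteq> ?V"
      by (auto simp: closed_nbhd_def)
    have "card (?R v) = card (?V - closed_nbhd G v) choose i"
      using fin by (simp add: n_subsets)
    moreover have "card (?V - closed_nbhd G v) \<le> n - c"
      using c[OF v] fin sub by (simp add: card_Diff_subset finite_subset n_def)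
    ultimately show "card (?R v) \<le> (n - c) choose i"
      by (simp add: binomial_right_mono)
  qed
  finally show ?thesis by (simp add: n_def)
qed

lemma choose_Suc_eq: "(n choose Suc i) * Suc i = (n choose i) * (n - i)"
proof (cases "i < n")
  case True
  then obtain m where "n = Suc m" by (cases n) auto
  then show ?thesis
    using True Suc_times_binomial[of i m] binomial_absorb_comp[of n i]
    by (simp add: mult.commute)
qed (simp add: binomial_eq_0)

text \<open>The drop from \<open>n choose i\<close> to \<open>n choose Suc i\<close> is (2i + 1 -
  n)/(i + 1) times \<open>n choose i\<close>. It has to absorb the non-dominating sets, of which
  there are at most \<open>n * ((n - c) choose i)\<close>.\<close>

lemma num_dominating_sets_antimono:
  assumes fin: "finite (pverts G)" and c: "\<And>v. v \<in> pverts G \<Longrightarrow> c \<le> card (closed_nbhd G v)"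
    and n: "n = card (pverts G)"
    and K: "n * (n + 4) \<le> 6 * K" "K * ((n - c) choose i) \<le> n choose i"
    and i: "n + 2 \<le> 2 * i" "i < n"
  shows "num_dominating_sets G (Suc i) \<le> num_dominating_sets G i"
proof -
  let ?B = "n choose i" and ?b = "(n - c) choose i"
  have "(n + 4) * (n * ?b) \<le> 6 * (K * ?b)"
    using mult_le_mono1[OF K(1), of ?b] by (simp add: ac_simps)
  also have "\<dots> \<le> 6 * ?B" using K(2) by simp
  finally have b: "(n + 4) * (n * ?b) \<le> 6 * ?B" .
  \<comment> \<open>For 2i >= n + 2 the ratio (i + 1)/(2i + 1 - n) is largest at 2i = n + 2, where
    it is (n + 4)/6. This is the source of the condition \<open>K(1)\<close>.\<close>
  have "6 * Suc i \<le> (n + 4) * (2 * i + 1 - n)"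
  proof -
    obtain s where s: "2 * i = n + 2 + s" using i(1) le_Suc_ex by metis
    then have "6 * Suc i = 3 * (n + 4 + s)" by simp
    also have "\<dots> \<le> (n + 4) * (3 + s)" by (simp add: algebra_simps)
    also have "3 + s = 2 * i + 1 - n" using s by simp
    finally show ?thesis .
  qed
  then have "Suc i * (6 * ?B) \<le> (n + 4) * ((2 * i + 1 - n) * ?B)"
    using mult_le_mono1[of "6 * Suc i" "(n + 4) * (2 * i + 1 - n)" ?B]
    by (simp only: mult.assoc mult.left_commute)
  then have "(n + 4) * (Suc i * (n * ?b)) \<le> (n + 4) * ((2 * i + 1 - n) * ?B)"
    using mult_le_mono2[OF b, of "Suc i"] by (simp only: mult.left_commute)
  then have "Suc i * (n * ?b) \<le> (2 * i + 1 - n) * ?B"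
    by (subst (asm) mult_le_cancel1) simp
  moreover have "(n choose Suc i) * Suc i = ?B * (n - i)" by (rule choose_Suc_eq)
  ultimately have "Suc i * (n * ?b + (n choose Suc i)) \<le> (2 * i + 1 - n) * ?B + (n - i) * ?B"
    by (simp only: distrib_left mult.commute[of "n - i"] mult.commute[of "Suc i" "n choose Suc i"])
  also have "\<dots> = (2 * i + 1 - n + (n - i)) * ?B" by (rule distrib_right[symmetric])
  also have "2 * i + 1 - n + (n - i) = Suc i" using i by simp
  finally have "n * ?b + (n choose Suc i) \<le> ?B"
    by (simp only: Suc_mult_le_cancel1)
  moreover have "?B \<le> num_dominating_sets G i + n * ?b"
    unfolding n by (rule choose_le_num_dominating_sets[OF fin c])
  moreover have "num_dominating_sets G (Suc i) \<le> n choose Suc i"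
    unfolding n by (rule num_dominating_sets_le_choose[OF fin])
  ultimately show ?thesis by linarith
qed

lemma degree_domination_polynomial:
  assumes "finite (pverts G)"
  shows "degree (domination_polynomial G) = card (pverts G)"
proof (rule antisym)
  show "degree (domination_polynomial G) \<le> card (pverts G)"
  proof (rule degree_le, intro allI impI)
    fix i assume "card (pverts G) < i"
    then show "coeff (domination_polynomial G) i = 0"
      using num_dominating_sets_le_choose[OF assms, of i]
      by (simp add: coeff_domination_polynomial[OF assms] binomial_eq_0)
  qed
  have "{U. dominating_set G U \<and> card U = card (pverts G)} = {pverts G}"
    using card_subset_eq[OF assms] by (auto simp: dominating_set_def)
  then show "card (pverts G) \<le> degree (domination_polynomial G)"
    by (intro le_degree) (simp add: coeff_domination_polynomial[OF assms] num_dominating_sets_def)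
qed

text \<open>Monotonicity holds up to the middle index \<open>p\<close>, antitonicity from \<open>p + 1\<close> on, so the
  comparison of the coefficients \<open>p\<close> and \<open>p + 1\<close> does not matter.\<close>

lemma unimodal_domination_polynomial:
  assumes fin: "finite (pverts G)" and c: "\<And>v. v \<in> pverts G \<Longrightarrow> c \<le> card (closed_nbhd G v)"
    and n: "n = card (pverts G)"
    and K: "n * (n + 4) \<le> 6 * K" "\<And>i. n + 2 \<le> 2 * i \<Longrightarrow> K * ((n - c) choose i) \<le> n choose i"
  shows "unimodal_poly (domination_polynomial G)"
proof -
  let ?d = "num_dominating_sets G"
  define p where "p = (n + 1) div 2"
  have up: "?d i \<le> ?d (Suc i)" if "i < p" for i
    using that num_dominating_sets_mono[OF fin, of i] by (simp add: p_def n)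
  have down: "?d (Suc i) \<le> ?d i" if "p < i" "i < n" for i
    using that num_dominating_sets_antimono[OF fin c n K(1) K(2)] by (simp add: p_def)
  \<comment> \<open>The guard \<open>p < n\<close> keeps the peak within the degree when n <=
    1.\<close>
  define k where "k = (if p < n \<and> ?d p \<le> ?d (Suc p) then Suc p else p)"
  have "p \<le> n" by (auto simp: p_def)
  then have "k \<le> n" by (auto simp: k_def)
  moreover have "?d i \<le> ?d (Suc i)" if "i < k" for i
    using that up by (cases "i = p") (auto simp: k_def split: if_splits)
  moreover have "?d (Suc i) \<le> ?d i" if "k \<le> i" "i < n" for i
    using that down by (cases "i = p") (auto simp: k_def split: if_splits)
  ultimately show ?thesis
    unfolding unimodal_poly_def degree_domination_polynomial[OF fin]
      coeff_domination_polynomial[OF fin] n[symmetric] by auto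
qed

section \<open>Orders and closed neighbourhoods of products of complete graphs\<close>

lemma card_list_all2_mem:
  assumes "\<And>A. A \<in> set As \<Longrightarrow> finite A"
  shows "finite {xs. list_all2 (\<in>) xs As} \<and> card {xs. list_all2 (\<in>) xs As} = (\<Prod>A\<leftarrow>As. card A)"
  using assms
proof (induction As)
  case (Cons A As)
  have "{xs. list_all2 (\<in>) xs (A # As)} =
      (\<lambda>(x, xs). x # xs) ` (A \<times> {xs. list_all2 (\<in>) xs As})"
    by (auto simp: list_all2_Cons2 image_iff)
  moreover have "inj_on (\<lambda>(x, xs). x # xs) (A \<times> {xs. list_all2 (\<in>) xs As})"
    by (auto simp: inj_on_def)
  ultimately show ?case
    using Cons by (simp add: card_image)
qed simp

abbreviation complete_product :: "nat list \<Rightarrow> nat list pair_pre_digraph" where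
  "complete_product ns \<equiv> direct_product_list (map complete_graph ns)"

lemma pverts_complete_product:
  "ns \<noteq> [] \<Longrightarrow> pverts (complete_product ns) = {vs. list_all2 (<) vs ns}"
  by (simp add: pverts_direct_product_list list_all2_map2 complete_graph_def)

lemma parcs_complete_product:
  "ns \<noteq> [] \<Longrightarrow> (us, vs) \<in> parcs (complete_product ns) \<longleftrightarrow>
     list_all2 (<) us ns \<and> list_all2 (<) vs ns \<and> (\<forall>i < length ns. us ! i \<noteq> vs ! i)"
  by (auto simp: parcs_direct_product_list list_all2_conv_all_nth complete_graph_def)

lemma card_pverts_complete_product:
  assumes "ns \<noteq> []"
  shows "finite (pverts (complete_product ns)) \<and> card (pverts (complete_product ns)) = prod_list ns"
proof -
  have "finite {vs. list_all2 (<) vs ns} \<and> card {vs. list_all2 (<) vs ns} = prod_list ns"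
    using card_list_all2_mem[of "map lessThan ns"] by (auto simp: list_all2_map2 comp_def)
  then show ?thesis using assms by (simp add: pverts_complete_product)
qed

text \<open>A neighbour avoids the entry of \<open>vs\<close> independently in each coordinate;
  \<open>Suc\<close> counts \<open>vs\<close> itself. The size is the same at every vertex, so one
  \<open>c\<close> serves the whole graph.\<close>

lemma card_closed_nbhd_complete_product:
  assumes ns: "ns \<noteq> []" and vs: "vs \<in> pverts (complete_product ns)"
  shows "card (closed_nbhd (complete_product ns) vs) = Suc (\<Prod>n\<leftarrow>ns. n - 1)"
proof -
  let ?As = "map2 (\<lambda>n v. {..<n} - {v}) ns vs"
  have len: "length vs = length ns" and lt: "list_all2 (<) vs ns"
    using ns vs by (auto simp: pverts_complete_product dest: list_all2_lengthD)
  have "{us. list_all2 (\<in>) us ?As} =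
      {us. list_all2 (<) us ns \<and> (\<forall>i < length ns. us ! i \<noteq> vs ! i)}"
    using len by (auto simp: list_all2_conv_all_nth)
  then have "closed_nbhd (complete_product ns) vs = insert vs {us. list_all2 (\<in>) us ?As}"
    using ns vs lt by (auto simp: closed_nbhd_def parcs_complete_product pverts_complete_product)
  \<comment> \<open>With no coordinates the empty list would vacuously differ from itself
    everywhere, so \<open>ns\<close> must be nonempty here.\<close>
  moreover have "vs \<notin> {us. list_all2 (\<in>) us ?As}"
    using ns len by (auto simp: list_all2_conv_all_nth)
  moreover have "map card ?As = map (\<lambda>n. n - 1) ns"
    using len lt by (auto simp: list_all2_conv_all_nth intro!: nth_equalityI)
  moreover have "finite {us. list_all2 (\<in>) us ?As} \<and>
      card {us. list_all2 (\<in>) us ?As} = (\<Prod>A\<leftarrow>?As. card A)"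
    by (rule card_list_all2_mem) auto
  ultimately show ?thesis by (simp del: map_map)
qed

section \<open>Obstructions to connectedness\<close>

lemma connected_imp_invariant_eq:
  assumes "Digraph_Component.connected (with_proj G)"
    and "\<And>u v. (u, v) \<in> parcs G \<Longrightarrow> f u = f v"
    and "u \<in> pverts G" "v \<in> pverts G"
  shows "f u = f v"
proof -
  have "(u, v) \<in> rtrancl_on (pverts G) (parcs (mk_symmetric (with_proj G)))"
    using assms(1,3,4)
    by (auto simp: Digraph_Component.connected_def strongly_connected_def reachable_def)
  then show ?thesis
    by (induction rule: rtrancl_on_induct) (auto simp: parcs_mk_symmetric dest: assms(2))
qed

text \<open>A coordinate with a single value cannot change along an arc, so there are no arcs and
  even \<open>id\<close> is invariant; this leaves one vertex.\<close>

lemma connected_complete_product_1: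
  assumes conn: "Digraph_Component.connected (with_proj (complete_product ns))"
    and ns: "ns \<noteq> []" and 1: "1 \<in> set ns"
  shows "prod_list ns = 1"
proof -
  let ?V = "pverts (complete_product ns)"
  obtain i where i: "i < length ns" "ns ! i = 1" using 1 by (auto simp: in_set_conv_nth)
  have "(us, vs) \<notin> parcs (complete_product ns)" for us vs
    using ns i by (fastforce simp: parcs_complete_product list_all2_conv_all_nth)
  then have "u = v" if "u \<in> ?V" "v \<in> ?V" for u v
    using connected_imp_invariant_eq[OF conn, of id u v] that by auto
  moreover have "?V \<noteq> {}"
    using conn by (auto simp: Digraph_Component.connected_def strongly_connected_def)
  ultimately have "card ?V = 1"
    using card_1_singleton_iff[of ?V] by (metis One_nat_def is_singletonI' is_singleton_altdef)
  then show ?thesis using card_pverts_complete_product[OF ns] by simp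
qed

text \<open>Two factors \<open>K\<^sub>2\<close> would make the parity of the sum of the two coordinates invariant
  along every edge.\<close>

lemma connected_complete_product_2:
  assumes conn: "Digraph_Component.connected (with_proj (complete_product ns))"
    and pos: "\<forall>n \<in> set ns. 1 \<le> n"
    and a: "a < length ns" "ns ! a = 2" and b: "b < length ns" "ns ! b = 2"
  shows "a = b"
proof (rule ccontr)
  assume "a \<noteq> b"
  have ns: "ns \<noteq> []" using a by auto
  define u where "u = replicate (length ns) (0::nat)"
  \<comment> \<open>Coordinates a and b take the values 0 and 1, so \<open>f\<close> records their
    parity. Every arc flips both, whereas \<open>u\<close> and \<open>u[a := 1]\<close> differ in
    only one.\<close>
  define f where "f = (\<lambda>us :: nat list. us ! a = us ! b)"
  have u: "u \<in> pverts (complete_product ns)" "u[a := 1] \<in> pverts (complete_product ns)"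
    using pos a nth_mem[of _ ns]
    by (auto simp: u_def pverts_complete_product[OF ns] list_all2_conv_all_nth nth_list_update
        less_eq_Suc_le)
  have f: "f us = f vs" if "(us, vs) \<in> parcs (complete_product ns)" for us vs
  proof -
    have "us ! a < 2" "vs ! a < 2" "us ! b < 2" "vs ! b < 2" "us ! a \<noteq> vs ! a" "us ! b \<noteq> vs ! b"
      using that a b ns by (auto simp: parcs_complete_product list_all2_conv_all_nth)
    then show ?thesis by (auto simp: f_def)
  qed
  have "f u = f (u[a := 1])"
    using conn f u by (rule connected_imp_invariant_eq)
  then show False
    using \<open>a \<noteq> b\<close> a b by (simp add: f_def u_def)
qed

section \<open>Binomial ratios and the numerical criterion\<close>

lemma choose_halving:
  assumes "m + 1 \<le> 2 * i"
  shows "2 * (m choose i) \<le> Suc m choose i"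
proof -
  obtain j where "i = Suc j" using assms by (cases i) auto
  \<comment> \<open>Past the middle the row does not increase, so in Pascal's rule the other summand
    is at least \<open>m choose i\<close>.\<close>
  have "(m choose Suc j) * Suc j \<le> (m choose j) * Suc j"
    unfolding choose_Suc_eq using assms \<open>i = Suc j\<close> by (intro mult_le_mono2) auto
  then have "m choose Suc j \<le> m choose j"
    by (simp only: mult_le_cancel2)
  then show ?thesis using \<open>i = Suc j\<close> by simp
qed

lemma choose_halving_power:
  assumes "m + c \<le> 2 * i"
  shows "2 ^ c * (m choose i) \<le> (m + c) choose i"
  using assms
proof (induction c)
  case (Suc c)
  then show ?case using choose_halving[of "m + c" i] by simp
qed simp

text \<open>Passing from j to j + 1 multiplies the two sides by (m - j)/(j + 1) and (n - j)/(j + 1),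
  and m <= n.\<close>

lemma choose_ratio_mono:
  assumes "m \<le> n" "i \<le> j" "K * (m choose i) \<le> n choose i"
  shows "K * (m choose j) \<le> n choose j"
  using assms(2)
proof (induction rule: dec_induct)
  case (step j)
  have "K * (m choose Suc j) * Suc j = K * (m choose j) * (m - j)"
    by (simp only: mult.assoc choose_Suc_eq)
  also have "\<dots> \<le> (n choose j) * (n - j)"
    using step.IH \<open>m \<le> n\<close> by (intro mult_le_mono) auto
  also have "\<dots> = (n choose Suc j) * Suc j" by (simp only: choose_Suc_eq)
  finally show ?case by (simp only: mult_le_cancel2)
qed (fact assms)

text \<open>Packages the conditions on \<open>K\<close> in
  \<open>unimodal_domination_polynomial\<close>, so that only arithmetic in the order
  \<open>n\<close> and the closed neighbourhood size \<open>c\<close> remains.\<close>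

definition admissible :: "nat \<Rightarrow> nat \<Rightarrow> bool" where
  "admissible n c \<longleftrightarrow> (\<exists>K. n * (n + 4) \<le> 6 * K \<and>
     (\<forall>i. n + 2 \<le> 2 * i \<longrightarrow> K * ((n - c) choose i) \<le> n choose i))"

lemma admissible_small:
  assumes "2 * (n - c) < n + 2"
  shows "admissible n c"
  unfolding admissible_def using assms
  \<comment> \<open>The smaller binomial coefficient vanishes at every relevant index, so any large
    enough K works.\<close>
  by (intro exI[of _ "n * (n + 4)"]) (auto simp: binomial_eq_0)

text \<open>Here K is \<open>2 ^ Suc d\<close>, from \<open>Suc d\<close> halvings, and 12 * 2^d is
  6K.\<close>

lemma admissible_power:
  assumes "n * (n + 4) \<le> 12 * 2 ^ d"
  shows "admissible n (Suc d)"
proof (cases "Suc d \<le> n")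
  case True
  then show ?thesis
    unfolding admissible_def using assms choose_halving_power[of "n - Suc d" "Suc d"]
    by (intro exI[of _ "2 ^ Suc d"]) auto
qed (auto intro: admissible_small)

text \<open>The ratio of \<open>n choose i\<close> to \<open>(n - c) choose i\<close> increases with \<open>i\<close>, so only the smallest
  relevant index has to be checked.\<close>

lemma admissible_single:
  assumes "n * (n + 4) \<le> 6 * K" "even n" "K * ((n - c) choose (n div 2 + 1)) \<le> n choose (n div 2 + 1)"
  shows "admissible n c"
  unfolding admissible_def
  by (intro exI[of _ K] conjI allI impI assms choose_ratio_mono[OF _ _ assms(3)]) auto

text \<open>This is \<open>K\<^sub>2 \<times> K\<^sub>3 \<times> K\<^sub>3\<close>. The least
  possible K is 18 * 22 / 6 = 66, above 2^5.\<close>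

lemma admissible_18: "admissible 18 5"
  by (rule admissible_single[of _ 66]) (simp_all add: binomial_fact' fact_numeral)

text \<open>This is \<open>K\<^sub>2 \<times> K\<^sub>3 \<times> K\<^sub>3 \<times>
  K\<^sub>3\<close>. The least possible K is 54 * 58 / 6 = 522, just above 2^9 = 512.\<close>

lemma admissible_54: "admissible 54 9"
  by (rule admissible_single[of _ 522]) (simp_all add: binomial_fact' fact_numeral)

section \<open>Growth of products of factors of size at least 3\<close>

lemma square_le_power_16: "3 \<le> m \<Longrightarrow> m ^ 2 \<le> (16::nat) ^ (m - 2)"
proof -
  have "(k + 3) ^ 2 \<le> (16::nat) ^ (k + 1)" for k
    by (induction k) (auto simp: power2_eq_square algebra_simps)
  then show ?thesis if "3 \<le> m" using le_Suc_ex[OF that] by (auto simp: add.commute)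
qed

lemma square_le_power_8: "4 \<le> m \<Longrightarrow> m ^ 2 \<le> (8::nat) ^ (m - 2)"
proof -
  have "(k + 4) ^ 2 \<le> (8::nat) ^ (k + 2)" for k
    by (induction k) (auto simp: power2_eq_square algebra_simps)
  then show ?thesis if "4 \<le> m" using le_Suc_ex[OF that] by (auto simp: add.commute)
qed

text \<open>A new factor m costs at most m^2 on the left and gains (m - 2) * d in the exponent. The
  square bounds pay for this: base 16 when d >= 4, base 8 when d >= 3 and m >= 4.\<close>

lemma product_bound_step:
  fixes m N :: nat
  assumes N: "N * (N + 2) \<le> 3 * 2 ^ d" and m: "2 \<le> m" "m ^ 2 \<le> 2 ^ ((m - 2) * d)"
  shows "m * N * (m * N + 2) \<le> 3 * 2 ^ ((m - 1) * d)"
proof -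
  have "m * N * (m * N + 2) \<le> m * N * (m * N + m * 2)"
    using m(1) by (intro mult_le_mono2) auto
  also have "\<dots> = m ^ 2 * (N * (N + 2))"
    by (simp add: power2_eq_square algebra_simps)
  also have "\<dots> \<le> 2 ^ ((m - 2) * d) * (3 * 2 ^ d)"
    using m(2) N by (rule mult_le_mono)
  also have "\<dots> = 3 * 2 ^ ((m - 2) * d + d)" by (simp add: power_add)
  also have "(m - 2) * d + d = (m - 1) * d"
    using m(1) by (auto dest!: le_Suc_ex)
  finally show ?thesis .
qed

lemma two_factor_bound:
  fixes m k :: nat
  assumes "3 \<le> m" "m \<le> k" "4 \<le> k"
  shows "m * k * (m * k + 2) \<le> 3 * 2 ^ ((m - 1) * (k - 1))"
proof (cases "m = 3")
  case True
  \<comment> \<open>The step lemma does not cover m = 3, k = 4, as 9 > 2^3; hence a direct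
    induction.\<close>
  have "(l + 4) * (3 * (l + 4) + 2) \<le> (4::nat) ^ (l + 3)" for l
    by (induction l) (auto simp: algebra_simps power_add)
  from this[of "k - 4"] have "k * (3 * k + 2) \<le> 2 ^ (2 * (k - 1))"
    using assms(3) by (simp add: power_mult)
  then show ?thesis using True by simp
next
  case False
  have "(l + 4) * (l + 6) \<le> 3 * (2::nat) ^ (l + 3)" for l
    by (induction l) (auto simp: algebra_simps power_add)
  from this[of "k - 4"] have k: "k * (k + 2) \<le> 3 * 2 ^ (k - 1)"
    using assms(3) by simp
  have "m ^ 2 \<le> 8 ^ (m - 2)" using False assms(1) by (intro square_le_power_8) simp
  also have "\<dots> = 2 ^ ((m - 2) * 3)" by (simp add: power_mult mult.commute)
  also have "\<dots> \<le> 2 ^ ((m - 2) * (k - 1))" using assms(3) by (intro power_increasing) auto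
  finally show ?thesis using product_bound_step[OF k] assms(1) by simp
qed

text \<open>The final bound is the criterion of \<open>admissible_power\<close> for n = 2N. It fails
  for 3 * 3 (99 > 48) and 3 * 3 * 3 (783 > 768). The clause \<open>6 \<le> d\<close> lets the
  induction use base 16.\<close>

lemma product_bound:
  assumes "\<forall>m \<in> set ms. 3 \<le> m"
  defines "N \<equiv> prod_list ms" and "d \<equiv> (\<Prod>m\<leftarrow>ms. m - 1)"
  shows "ms = [] \<or> (\<exists>m\<ge>3. ms = [m]) \<or> N = 9 \<and> d = 4 \<or> N = 27 \<and> d = 8 \<or>
    6 \<le> d \<and> N * (N + 2) \<le> 3 * 2 ^ d"
  using assms(1) unfolding N_def d_def
proof (induction ms)
  case (Cons m ms)
  let ?N = "prod_list ms" and ?d = "\<Prod>m\<leftarrow>ms. m - 1"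
  have m: "3 \<le> m" using Cons.prems by simp
  have big: "6 \<le> (m - 1) * d" if "4 \<le> d" for d
    using mult_le_mono[of 2 "m - 1" 4 d] m that by linarith
  have "\<forall>m \<in> set ms. 3 \<le> m" using Cons.prems by simp
  from Cons.IH[OF this] consider "ms = []" | k where "3 \<le> k" "ms = [k]" | "?N = 9" "?d = 4"
    | "?N = 27" "?d = 8" | "6 \<le> ?d" "?N * (?N + 2) \<le> 3 * 2 ^ ?d"
    by blast
  then show ?case
  proof cases
    case 1
    then show ?thesis using m by simp
  next
    case (2 k)
    show ?thesis
    proof (cases "m = 3 \<and> k = 3")
      case False
      have "m * k * (m * k + 2) \<le> 3 * 2 ^ ((m - 1) * (k - 1))"
        using two_factor_bound[of m k] two_factor_bound[of k m] m 2(1) False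
        by (cases "m \<le> k") (auto simp: mult.commute)
      moreover have "6 \<le> (m - 1) * (k - 1)"
        using mult_le_mono[of 2 "m - 1" 3 "k - 1"] mult_le_mono[of 3 "m - 1" 2 "k - 1"] m 2(1) False
        by linarith
      ultimately show ?thesis using 2(2) by simp
    qed (simp add: 2)
  next
    case 3
    show ?thesis
    proof (cases "m = 3")
      case False
      \<comment> \<open>Here and in the next case a factor 3 is cancelled from the target
        bound.\<close>
      have "(3 * (l + 4)) * (9 * (l + 4) + 2) \<le> (16::nat) ^ (l + 3)" for l
        by (induction l) (auto simp: algebra_simps power_add)
      from this[of "m - 4"] have "(3 * m) * (9 * m + 2) \<le> 2 ^ (4 * (m - 1))"
        using m False by (simp add: power_mult)
      then show ?thesis using 3 m by (auto simp: mult.commute)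
    qed (use 3 in simp)
  next
    case 4
    obtain l where l: "m = l + 3" using le_Suc_ex[OF m] by (auto simp: add.commute)
    have "(9 * (l + 3)) * (27 * (l + 3) + 2) \<le> (256::nat) ^ (l + 2)" for l
      by (induction l) (auto simp: algebra_simps power_add)
    from this[of l] have "(9 * m) * (27 * m + 2) \<le> 2 ^ (8 * (m - 1))"
      by (simp add: l power_mult power_add)
    then show ?thesis using 4 m by (auto simp: mult.commute)
  next
    case 5
    have "m ^ 2 \<le> 16 ^ (m - 2)" by (rule square_le_power_16[OF m])
    also have "\<dots> = 2 ^ ((m - 2) * 4)" by (simp add: power_mult mult.commute)
    also have "\<dots> \<le> 2 ^ ((m - 2) * ?d)" using 5(1) by (intro power_increasing) auto
    finally have "m * ?N * (m * ?N + 2) \<le> 3 * 2 ^ ((m - 1) * ?d)"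
      using product_bound_step[OF 5(2)] m by simp
    then show ?thesis using 5(1) big by simp
  qed
qed simp

lemma admissible_product:
  assumes "ns \<noteq> []" and "\<forall>n \<in> set ns. 1 \<le> n"
    and one: "1 \<in> set ns \<Longrightarrow> prod_list ns = 1"
    and two: "\<And>a b. \<lbrakk>a < length ns; ns ! a = 2; b < length ns; ns ! b = 2\<rbrakk> \<Longrightarrow> a = b"
  shows "admissible (prod_list ns) (Suc (\<Prod>n\<leftarrow>ns. n - 1))"
proof -
  consider "1 \<in> set ns" | "1 \<notin> set ns" "2 \<notin> set ns" | "1 \<notin> set ns" "2 \<in> set ns" by blast
  then show ?thesis
  proof cases
    case 1
    then show ?thesis using one by (auto intro: admissible_small)
  next
    case 2
    let ?N = "prod_list ns" and ?d = "\<Prod>n\<leftarrow>ns. n - 1"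
    have "3 \<le> n" if "n \<in> set ns" for n
    proof -
      have "n \<noteq> 1" "n \<noteq> 2" "1 \<le> n" using 2 that assms(2) by auto
      then show ?thesis by linarith
    qed
    then consider m where "3 \<le> m" "ns = [m]" | "?N = 9" "?d = 4" | "?N = 27" "?d = 8"
      | "?N * (?N + 2) \<le> 3 * 2 ^ ?d"
      using product_bound[of ns] assms(1) by blast
    then show ?thesis
    proof cases
      case 4
      have "?N * (?N + 4) \<le> 2 * (?N * (?N + 2))" by (simp add: algebra_simps)
      with 4 show ?thesis by (intro admissible_power) linarith
    \<comment> \<open>A single factor is its own closed neighbourhood; order 9 has 2 * (9 - 5) < 11;
      order 27 has 27 * 31 <= 12 * 2^8.\<close>
    qed (use admissible_small admissible_power[of 27 8] in auto)
  next
    case 3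
    then obtain xs ys where ns: "ns = xs @ 2 # ys" by (meson split_list)
    let ?N = "prod_list (xs @ ys)" and ?d = "\<Prod>n\<leftarrow>xs @ ys. n - 1"
    have "2 \<notin> set xs"
    proof
      assume "2 \<in> set xs"
      then obtain j where "j < length xs" "xs ! j = 2" by (auto simp: in_set_conv_nth)
      then show False using two[of j "length xs"] by (simp add: ns nth_append)
    qed
    moreover have "2 \<notin> set ys"
    proof
      assume "2 \<in> set ys"
      then obtain j where "j < length ys" "ys ! j = 2" by (auto simp: in_set_conv_nth)
      then show False using two[of "length xs" "length xs + Suc j"] by (simp add: ns nth_append)
    qed
    ultimately have "3 \<le> n" if "n \<in> set (xs @ ys)" for n
    proof -
      have "n \<noteq> 1" "n \<noteq> 2" "1 \<le> n"
        using 3(1) that assms(2) \<open>2 \<notin> set xs\<close> \<open>2 \<notin> set ys\<close> by (auto simp: ns)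
      then show ?thesis by linarith
    qed
    then consider "xs @ ys = []" | m where "3 \<le> m" "xs @ ys = [m]" | "?N = 9" "?d = 4"
      | "?N = 27" "?d = 8" | "?N * (?N + 2) \<le> 3 * 2 ^ ?d"
      using product_bound[of "xs @ ys"] by blast
    \<comment> \<open>The factor \<open>K\<^sub>2\<close> doubles the order but contributes 2 - 1 =
      1 to the product of the degrees.\<close>
    then have "admissible (2 * ?N) (Suc ?d)"
    proof cases
      case 5
      then show ?thesis by (intro admissible_power) (simp add: algebra_simps)
    qed (use admissible_18 admissible_54 in
        \<open>auto intro!: admissible_small simp del: map_append prod_list.append\<close>)
    moreover have "prod_list ns = 2 * ?N" "(\<Prod>n\<leftarrow>ns. n - 1) = ?d" by (simp_all add: ns)
    ultimately show ?thesis by simp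
  qed
qed

theorem theorem5p5:
  fixes ns :: "nat list"
  assumes "length ns \<ge> 1"
    and "\<forall>n \<in> set ns. n \<ge> 1"
    and "Digraph_Component.connected
           (with_proj (direct_product_list (map complete_graph ns)))"
  shows "unimodal_poly
           (domination_polynomial (direct_product_list (map complete_graph ns)))"
proof -
  have ns: "ns \<noteq> []" using assms(1) by auto
  obtain K where K: "prod_list ns * (prod_list ns + 4) \<le> 6 * K"
    "\<And>i. prod_list ns + 2 \<le> 2 * i \<Longrightarrow>
       K * ((prod_list ns - Suc (\<Prod>n\<leftarrow>ns. n - 1)) choose i) \<le> prod_list ns choose i"
    using admissible_product[OF ns assms(2) connected_complete_product_1[OF assms(3) ns]
        connected_complete_product_2[OF assms(3,2)]]
    unfolding admissible_def by blast
  note V = card_pverts_complete_product[OF ns]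
  show ?thesis
    by (rule unimodal_domination_polynomial[OF conjunct1[OF V] _ conjunct2[OF V, symmetric] K])
      (simp_all add: card_closed_nbhd_complete_product[OF ns])
qed

end
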